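(* Let $m \geq n \geq 1$ be integers, and let $k_2$ be an integer with $\lfloor \frac{m}{2} \rfloor \leq k_2 < m$. Then the number of ways to distribute $m$ identical balls into $n$ distinct boxes (empty boxes allowed) so that each box contains at most $k_2$ balls is $$\binom{m + n - 1}{n-1} - \binom{n}{1} \binom{m - k_2 + n - 2}{n-1}.$$
   Context: A distribution of $m$ identical balls into $n$ distinct boxes is an $n$-tuple $(X_1,\dots,X_n)$ of nonnegative integers with $X_1+\cdots+X_n=m$ (all balls are distributed with no remainder), where $X_i$ is the number of balls in box $i$. The number of ways is the number of such tuples satisfying the stated constraints. *)

theory Defs
  imports Complex_Main
begin

definition distributions :: "nat \<Rightarrow> nat \<Rightarrow> nat list set" where
  "distributions m n = {X. length X = n \<and> (\<Sum>i<n. X ! i) = m}"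

end

theory Submission
  imports Defs
begin

text \<open>Inclusion-exclusion stops after the first term: since \<open>2 * (k\<^sub>2 + 1) > m\<close>, at most one
box can hold more than \<open>k\<^sub>2\<close> balls. Removing \<open>k\<^sub>2 + 1\<close> balls from that box leaves an arbitrary
distribution of \<open>m - k\<^sub>2 - 1\<close> balls.\<close>

text \<open>Stars and bars. The assumption \<open>n \<ge> 1\<close> gives
  \<open>m \<le> m + n - 1\<close>, which the symmetry of the binomial coefficient requires.\<close>

lemma card_distributions:
  assumes "n \<ge> 1"
  shows "card (distributions m n) = (m + n - 1) choose (n - 1)"
proof -
  have "distributions m n = {l. length l = n \<and> sum_list l = m}"
    by (auto simp: distributions_def sum_list_sum_nth atLeast0LessThan)
  then have "card (distributions m n) = (m + n - 1) choose m"
    by (simp add: card_length_sum_list)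
  also have "\<dots> = (m + n - 1) choose (n - 1)"
    using assms binomial_symmetric[of m "m + n - 1"] by simp
  finally show ?thesis .
qed

text \<open>An infinite set has \<open>card\<close> equal to 0, so the positive count above already
  forces finiteness.\<close>

lemma finite_distributions:
  assumes "n \<ge> 1"
  shows "finite (distributions m n)"
proof (rule card_ge_0_finite)
  show "card (distributions m n) > 0"
    using assms by (simp add: card_distributions)
qed

lemma sum_nth_list_update:
  fixes X :: "'a::comm_monoid_add list"
  assumes "length X = n" "i < n"
  shows "(\<Sum>j<n. X[i := v] ! j) = v + (\<Sum>j\<in>{..<n} - {i}. X ! j)"
proof -
  have "(\<Sum>j<n. X[i := v] ! j) = X[i := v] ! i + (\<Sum>j\<in>{..<n} - {i}. X[i := v] ! j)"
    using assms by (intro sum.remove) auto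
  also have "(\<Sum>j\<in>{..<n} - {i}. X[i := v] ! j) = (\<Sum>j\<in>{..<n} - {i}. X ! j)"
    by (intro sum.cong) auto
  finally show ?thesis
    using assms by simp
qed

text \<open>Taking \<open>c\<close> balls out of box \<open>i\<close> is undone by putting them
  back. With \<open>c > m\<close> the left side would be 0, but truncated subtraction would make the
  right side 1.\<close>

lemma card_distributions_nth_ge:
  assumes "i < n" "c \<le> m"
  shows "card {X \<in> distributions m n. X ! i \<ge> c} = card (distributions (m - c) n)"
proof -
  \<comment> \<open>Has the same remainder as \<open>sum_nth_list_update\<close>, so the totals
    before and after the update are compared through box \<open>i\<close> alone.\<close>
  have split: "(\<Sum>j<n. X ! j) = X ! i + (\<Sum>j\<in>{..<n} - {i}. X ! j)" for X :: "nat list"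
    using assms by (intro sum.remove) auto
  have "bij_betw (\<lambda>X. X[i := X ! i - c])
    {X \<in> distributions m n. X ! i \<ge> c} (distributions (m - c) n)"
  proof (rule bij_betw_byWitness[where f' = "\<lambda>X. X[i := X ! i + c]"])
    show "(\<lambda>X. X[i := X ! i - c]) ` {X \<in> distributions m n. X ! i \<ge> c}
        \<subseteq> distributions (m - c) n"
      using assms by (auto simp: distributions_def sum_nth_list_update split)
    show "(\<lambda>X. X[i := X ! i + c]) ` distributions (m - c) n
        \<subseteq> {X \<in> distributions m n. X ! i \<ge> c}"
      using assms by (auto simp: distributions_def sum_nth_list_update split)
  qed (use assms in \<open>auto simp: distributions_def\<close>)
  then show ?thesis
    by (rule bij_betw_same_card)
qed

theorem mainTheorem2:
  fixes m n k\<^sub>2 :: nat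
  assumes "m \<ge> n" and "n \<ge> 1"
    and "m div 2 \<le> k\<^sub>2" and "k\<^sub>2 < m"
  shows "int (card {X \<in> distributions m n. \<forall>i<n. X ! i \<le> k\<^sub>2}) =
    int ((m + n - 1) choose (n - 1)) - int (n choose 1) * int ((m - k\<^sub>2 + n - 2) choose (n - 1))"
proof -
  let ?D = "distributions m n"
  define A where "A = {X \<in> ?D. \<forall>i<n. X ! i \<le> k\<^sub>2}"
  define B where "B i = {X \<in> ?D. X ! i \<ge> Suc k\<^sub>2}" for i
  have fin: "finite ?D"
    using assms(2) by (rule finite_distributions)
  have finA: "finite A" and finB: "finite (B i)" for i
    using fin by (auto simp: A_def B_def)
  have D: "?D = A \<union> (\<Union>i<n. B i)"
    by (auto simp: A_def B_def not_le Suc_le_eq)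
  have "A \<inter> (\<Union>i<n. B i) = {}"
    by (auto simp: A_def B_def)
  then have "card ?D = card A + card (\<Union>i<n. B i)"
    unfolding D using finA finB by (intro card_Un_disjoint) auto
  also have "card (\<Union>i<n. B i) = (\<Sum>i<n. card (B i))"
  proof (rule card_UN_disjoint)
    show "\<forall>i\<in>{..<n}. \<forall>j\<in>{..<n}. i \<noteq> j \<longrightarrow> B i \<inter> B j = {}"
    proof (intro ballI impI equals0I)
      fix i j X
      assume ij: "i \<in> {..<n}" "j \<in> {..<n}" "i \<noteq> j" and X: "X \<in> B i \<inter> B j"
      have "X ! i + X ! j = (\<Sum>l\<in>{i, j}. X ! l)"
        using ij by simp
      also have "\<dots> \<le> (\<Sum>l<n. X ! l)"
        using ij by (intro sum_mono2) auto
      also have "\<dots> = m"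
        using X by (simp add: B_def distributions_def)
      finally have "X ! i + X ! j \<le> m" .
      moreover have "X ! i \<ge> Suc k\<^sub>2" "X ! j \<ge> Suc k\<^sub>2"
        using X by (auto simp: B_def)
      \<comment> \<open>The bound \<open>m div 2 \<le> k\<^sub>2\<close> means
        \<open>m \<le> 2 * k\<^sub>2 + 1\<close>, one less than the minimal content of two overfull
        boxes.\<close>
      ultimately show False
        using assms(3) by linarith
    qed
  qed (use finB in auto)
  also have "(\<Sum>i<n. card (B i)) = n * ((m - k\<^sub>2 + n - 2) choose (n - 1))"
  proof -
    \<comment> \<open>The left side is the upper index from stars and bars with
      \<open>m - Suc k\<^sub>2\<close> balls. No subtraction truncates, because
      \<open>k\<^sub>2 < m\<close> and \<open>n \<ge> 1\<close>.\<close>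
    have "m - Suc k\<^sub>2 + n - 1 = m - k\<^sub>2 + n - 2"
      using assms by simp
    then have "card (B i) = (m - k\<^sub>2 + n - 2) choose (n - 1)" if "i < n" for i
      using that assms by (simp add: B_def card_distributions_nth_ge card_distributions)
    then show ?thesis
      by simp
  qed
  finally have "card ?D = card A + n * ((m - k\<^sub>2 + n - 2) choose (n - 1))" .
  \<comment> \<open>The count is moved to \<open>int\<close> while still a sum, so that solving for
    \<open>card A\<close> uses genuine subtraction.\<close>
  then have "int ((m + n - 1) choose (n - 1)) =
      int (card A) + int n * int ((m - k\<^sub>2 + n - 2) choose (n - 1))"
    using assms(2) by (metis card_distributions of_nat_add of_nat_mult)
  then show ?thesis
    by (simp add: A_def)
qed

end
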